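(* Suppose that $(Y_j)_{j\in\mathbb{N}}$ is a sequence of mutually independent real-valued random variables such that $\sum_{j=1}^\infty Y_j$ converges almost surely. Then the distribution of $\sum_{j=1}^\infty Y_j$ contains an atom on $\mathbb{R}$ if and only if there is a sequence $(c_j)_{j\in\mathbb{N}}\in\mathbb{R}^{\mathbb{N}}$ such that $$\forall j\in\mathbb{N}\quad \mathbb{P}(Y_j=c_j)>0\qquad\text{and}\qquad \sum_{j=1}^\infty\mathbb{P}(Y_j\neq c_j)<\infty.$$
   Context: The distribution of a real random variable $Y$ contains an atom if $\mathbb{P}(Y=c)>0$ for some $c\in\mathbb{R}$. A series converges if its partial sums converge to a finite real limit. *)

theory Defs
  imports "HOL-Probability.Probability"
begin

definition distribution_contains_atom :: "'a measure \<Rightarrow> ('a \<Rightarrow> real) \<Rightarrow> bool" where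
  "distribution_contains_atom M X \<longleftrightarrow> (\<exists>c. measure M {\<omega> \<in> space M. X \<omega> = c} > 0)"

end

(* If the sum S has an atom, then the tail sums R_n have atoms r_n of mass at least 3/4 for all
   n >= N: the event S = c is approximated by events depending only on Y_0, ..., Y_{n-1}, so it can
   only be likely given such an event if R_n is concentrated at a point. Take c_j = r_j - r_{j+1}
   for j >= N. Then R_N = r_N, although it is likely, is unlikely once some Y_j has left c_j, so all
   Y_j with j >= N equal c_j with positive probability; by independence this probability is a
   product, and its positivity is the summability of P(Y_j <> c_j). *)
theory Submission
  imports Defs
begin

section \<open>Atoms of a sum of two independent variables\<close>

text \<open>Given \<open>X = x\<close>, the sum equals \<open>c\<close> only if
  \<open>Z = c - x\<close>, and independence bounds the probability of this by \<open>q\<close>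
  whatever \<open>x\<close> is. Fubini then integrates the bound over \<open>x\<close> in
  \<open>B\<close>.\<close>

lemma (in prob_space) prob_indep_add_eq_le:
  fixes X Z :: "'a \<Rightarrow> real"
  assumes ind: "indep_var borel X borel Z"
    and B: "B \<in> sets borel"
    and q: "\<And>z. prob {\<omega> \<in> space M. Z \<omega> = z} \<le> q"
  shows "prob {\<omega> \<in> space M. X \<omega> \<in> B \<and> X \<omega> + Z \<omega> = c} \<le> q * prob {\<omega> \<in> space M. X \<omega> \<in> B}"
proof -
  have [measurable]: "random_variable borel X" "random_variable borel Z" "B \<in> sets borel"
    using indep_var_rv1[OF ind] indep_var_rv2[OF ind] B by auto
  have q0: "0 \<le> q" using q[of 0] measure_nonneg order_trans by blast
  interpret Z: prob_space "distr M borel Z" by (intro prob_space_distr) simp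
  define E where "E = {p :: real \<times> real. fst p \<in> B \<and> fst p + snd p = c}"
  have E': "E = {p \<in> space (borel \<Otimes>\<^sub>M borel). fst p \<in> B \<and> fst p + snd p = c}"
    by (simp add: E_def space_pair_measure)
  have E: "E \<in> sets (borel \<Otimes>\<^sub>M borel)"
    unfolding E' by measurable
  have "emeasure M {\<omega> \<in> space M. X \<omega> \<in> B \<and> X \<omega> + Z \<omega> = c}
      = emeasure (distr M (borel \<Otimes>\<^sub>M borel) (\<lambda>\<omega>. (X \<omega>, Z \<omega>))) E"
    using E by (subst emeasure_distr) (auto simp: E_def intro!: arg_cong[where f="emeasure M"])
  also have "\<dots> = emeasure (distr M borel X \<Otimes>\<^sub>M distr M borel Z) E"
    using ind by (simp add: indep_var_distribution_eq)
  also have "\<dots> = (\<integral>\<^sup>+x. emeasure (distr M borel Z) (Pair x -` E) \<partial>distr M borel X)"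
    using E by (intro Z.emeasure_pair_measure_alt) simp
  also have "\<dots> \<le> (\<integral>\<^sup>+x. ennreal q * indicator B x \<partial>distr M borel X)"
  proof (intro nn_integral_mono)
    fix x :: real
    have "emeasure (distr M borel Z) {c - x} \<le> ennreal q"
      using q[of "c - x"]
      by (subst emeasure_distr) (auto simp: emeasure_eq_measure vimage_def Int_def conj_commute intro!: ennreal_leI)
    moreover have "Pair x -` E = (if x \<in> B then {c - x} else {})"
      by (auto simp: E_def)
    ultimately show "emeasure (distr M borel Z) (Pair x -` E) \<le> ennreal q * indicator B x"
      by simp
  qed
  also have "\<dots> = ennreal q * emeasure (distr M borel X) B"
    by (simp add: nn_integral_cmult_indicator)
  also have "\<dots> = ennreal q * emeasure M {\<omega> \<in> space M. X \<omega> \<in> B}"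
    by (subst emeasure_distr) (auto simp: vimage_def Int_def conj_commute)
  finally show ?thesis
    using q0 by (simp add: emeasure_eq_measure flip: ennreal_mult)
qed

section \<open>An atom of the limit concentrates the remainders\<close>

text \<open>Almost sure convergence implies convergence in probability: the indicators of the bad
  events tend to 0 almost surely and are dominated by 1.\<close>

lemma (in prob_space) prob_far_from_limit_tendsto_0:
  fixes X :: "nat \<Rightarrow> 'a \<Rightarrow> real"
  assumes [measurable]: "\<And>n. random_variable borel (X n)" "random_variable borel S"
    and lim: "AE \<omega> in M. (\<lambda>n. X n \<omega>) \<longlonglongrightarrow> S \<omega>" and "0 < d"
  shows "(\<lambda>n. prob {\<omega> \<in> space M. d < \<bar>X n \<omega> - S \<omega>\<bar>}) \<longlonglongrightarrow> 0"
proof -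
  define B where "B n = {\<omega> \<in> space M. d < \<bar>X n \<omega> - S \<omega>\<bar>}" for n
  have [measurable]: "B n \<in> events" for n unfolding B_def by measurable
  have "(\<lambda>n. \<integral>\<omega>. indicator (B n) \<omega> \<partial>M) \<longlonglongrightarrow> (\<integral>\<omega>. (0::real) \<partial>M)"
  proof (rule integral_dominated_convergence[where w="\<lambda>_. 1"])
    show "AE \<omega> in M. (\<lambda>n. indicator (B n) \<omega> :: real) \<longlonglongrightarrow> 0"
      using lim
    proof eventually_elim
      case (elim \<omega>)
      from tendstoD[OF elim \<open>0 < d\<close>] show ?case
        by (intro tendsto_eventually) (auto elim!: eventually_mono simp: B_def dist_real_def)
    qed
  qed auto
  then show ?thesis by (simp add: B_def)
qed

text \<open>For small \<open>\<delta>\<close> and large \<open>n\<close> the event \<open>\<bar>X n - c\<bar> \<le> \<delta>\<close> approximates \<open>S = c\<close>, but it is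
  independent of \<open>Z n\<close>.\<close>

lemma (in prob_space) residual_atom_of_limit_atom:
  fixes X Z :: "nat \<Rightarrow> 'a \<Rightarrow> real"
  assumes ind: "\<And>n. indep_var borel (X n) borel (Z n)"
    and S[measurable]: "random_variable borel S"
    and lim: "AE \<omega> in M. (\<lambda>n. X n \<omega>) \<longlonglongrightarrow> S \<omega>"
    and sum: "\<And>n. AE \<omega> in M. X n \<omega> + Z n \<omega> = S \<omega>"
    and atom: "prob {\<omega> \<in> space M. S \<omega> = c} > 0"
    and q: "0 \<le> q" "q < 1"
  shows "\<forall>\<^sub>F n in sequentially. \<exists>z. prob {\<omega> \<in> space M. Z n \<omega> = z} > q"
proof -
  have [measurable]: "random_variable borel (X n)" "random_variable borel (Z n)" for n
    using indep_var_rv1[OF ind] indep_var_rv2[OF ind] by auto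
  define p where "p = prob {\<omega> \<in> space M. S \<omega> = c}"
  \<comment> \<open>The size of \<open>e\<close> is dictated by the last estimate,
    \<open>p * (1 - q) \<le> e * (1 + 2 * q) < 4 * e\<close>, which this value turns into a
    contradiction.\<close>
  define e where "e = p * (1 - q) / 4"
  have p: "0 < p" and e: "0 < e" using atom q by (auto simp: p_def e_def)
  \<comment> \<open>The radius is twice the later \<open>d = 1 / real (Suc k)\<close>: if
    \<open>X n\<close> is within \<open>d\<close> of both \<open>c\<close> and \<open>S\<close>,
    then \<open>S\<close> is within \<open>2 * d\<close> of \<open>c\<close>.\<close>
  define D where "D k = {\<omega> \<in> space M. \<bar>S \<omega> - c\<bar> \<le> 2 / real (Suc k)}" for k
  have "(\<lambda>k. prob (D k)) \<longlonglongrightarrow> prob (\<Inter>k. D k)"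
  proof (rule finite_Lim_measure_decseq)
    show "range D \<subseteq> events" by (auto simp: D_def)
    show "decseq D" 
    proof (rule decseq_SucI)
      fix k
      have "2 / real (Suc (Suc k)) \<le> 2 / real (Suc k)" by (intro divide_left_mono) auto
      then show "D (Suc k) \<subseteq> D k" unfolding D_def by auto
    qed
  qed
  moreover have "(\<Inter>k. D k) = {\<omega> \<in> space M. S \<omega> = c}"
  proof safe
    fix \<omega> assume \<omega>: "\<omega> \<in> (\<Inter>k. D k)"
    have "(\<lambda>k. 2 * inverse (real (Suc k))) \<longlonglongrightarrow> 2 * 0"
      by (intro tendsto_mult tendsto_const LIMSEQ_inverse_real_of_nat)
    then have "\<bar>S \<omega> - c\<bar> \<le> 2 * 0"
      by (rule LIMSEQ_le_const) (use \<omega> in \<open>auto simp: D_def divide_inverse\<close>)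
    then show "S \<omega> = c" by simp
  qed (auto simp: D_def)
  ultimately have "(\<lambda>k. prob (D k)) \<longlonglongrightarrow> p" by (simp add: p_def)
  then have "\<forall>\<^sub>F k in sequentially. prob (D k) < p + e"
    using e by (intro order_tendstoD) auto
  then obtain k where k: "prob (D k) < p + e"
    by (auto simp: eventually_sequentially)
  define d where "d = 1 / real (Suc k)"
  have d: "0 < d" by (simp add: d_def)
  define B where "B n = {\<omega> \<in> space M. d < \<bar>X n \<omega> - S \<omega>\<bar>}" for n
  define A where "A n = {\<omega> \<in> space M. X n \<omega> \<in> cball c d}" for n
  have [measurable]: "cball c d \<in> sets borel" by simp
  have [measurable]: "B n \<in> events" "A n \<in> events" "D k \<in> events" for n
    unfolding B_def A_def D_def by measurable
  have "(\<lambda>n. prob (B n)) \<longlonglongrightarrow> 0"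
    unfolding B_def using lim d by (intro prob_far_from_limit_tendsto_0) auto
  then have "\<forall>\<^sub>F n in sequentially. prob (B n) < e"
    using e by (intro order_tendstoD)
  then show ?thesis
  proof eventually_elim
    case (elim n)
    show ?case
    proof (rule ccontr)
      assume "\<not> ?thesis"
      then have q': "prob {\<omega> \<in> space M. Z n \<omega> = z} \<le> q" for z
        by (simp add: not_less)
      \<comment> \<open>Off \<open>B n\<close>, the event \<open>S = c\<close> forces
        \<open>X n\<close> into the ball around \<open>c\<close>. Replacing \<open>S\<close> by
        \<open>X n + Z n\<close> then lets independence contribute the factor
        \<open>q\<close>.\<close>
      have "p \<le> prob ({\<omega> \<in> space M. X n \<omega> \<in> cball c d \<and> S \<omega> = c} \<union> B n)"
        unfolding p_def by (intro finite_measure_mono) (auto simp: B_def dist_real_def)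
      also have "\<dots> \<le> prob {\<omega> \<in> space M. X n \<omega> \<in> cball c d \<and> S \<omega> = c} + prob (B n)"
        by (intro measure_Un_le) auto
      also have "prob {\<omega> \<in> space M. X n \<omega> \<in> cball c d \<and> S \<omega> = c}
          = prob {\<omega> \<in> space M. X n \<omega> \<in> cball c d \<and> X n \<omega> + Z n \<omega> = c}"
        using sum[of n] by (intro finite_measure_eq_AE) auto
      also have "\<dots> \<le> q * prob (A n)"
        unfolding A_def by (rule prob_indep_add_eq_le[OF ind _ q']) auto
      \<comment> \<open>The approximation is now used in the other direction: \<open>X n\<close>
        near \<open>c\<close> means \<open>S\<close> near \<open>c\<close>, up to
        \<open>B n\<close>, and \<open>D k\<close> has probability hardly above
        \<open>p\<close>.\<close>
      also have "prob (A n) \<le> prob (D k \<union> B n)"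
        by (intro finite_measure_mono) (auto simp: A_def B_def D_def d_def dist_real_def)
      also have "\<dots> \<le> prob (D k) + prob (B n)"
        by (intro measure_Un_le) auto
      finally have "p \<le> q * (prob (D k) + prob (B n)) + prob (B n)"
        using q by (simp add: mult_left_mono)
      also have "\<dots> \<le> q * (p + e + e) + e"
        using k elim q by (intro add_mono mult_left_mono) auto
      finally have "p * (1 - q) \<le> e * (1 + 2 * q)"
        by (simp add: algebra_simps)
      also have "\<dots> < e * 4"
        using e q by (intro mult_strict_left_mono) auto
      finally show False by (simp add: e_def)
    qed
  qed
qed

section \<open>Series of independent variables: tails, summands and first departures\<close>

lemma suminf_eq_sum_plus_tail:
  fixes y :: "nat \<Rightarrow> real"
  assumes "summable y" "N \<le> n"
  shows "(\<Sum>j. y (j + N)) = sum y {N..<n} + (\<Sum>j. y (j + n))"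
proof -
  have "suminf y = (\<Sum>j. y (j + k)) + sum y {0..<k}" for k
    using suminf_split_initial_segment[OF assms(1), of k] by (simp only: atLeast0LessThan)
  from this[of N] this[of n] show ?thesis
    using sum.atLeastLessThan_concat[of 0 N n y] assms(2) by linarith
qed

lemma (in prob_space) indep_var_functions_of_disjoint:
  assumes ind: "indep_vars M' Y UNIV" and "A \<inter> B = {}"
    and F: "F \<in> measurable (PiM A M') N1" and G: "G \<in> measurable (PiM B M') N2"
  shows "indep_var N1 (\<lambda>\<omega>. F (restrict (\<lambda>i. Y i \<omega>) A)) N2 (\<lambda>\<omega>. G (restrict (\<lambda>i. Y i \<omega>) B))"
  using indep_var_compose[OF indep_var_restrict[OF ind assms(2) subset_UNIV subset_UNIV] F G]
  unfolding comp_def .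

lemma (in prob_space) indep_partial_sum_tail:
  fixes Y :: "nat \<Rightarrow> 'a \<Rightarrow> real"
  assumes ind: "indep_vars (\<lambda>_. borel) Y UNIV"
  shows "indep_var borel (\<lambda>\<omega>. \<Sum>j<n. Y j \<omega>) borel (\<lambda>\<omega>. \<Sum>j. Y (j + n) \<omega>)"
proof -
  have "(\<lambda>f. \<Sum>j<n. f j) \<in> borel_measurable (PiM {..<n} (\<lambda>_. borel :: real measure))"
    by (intro borel_measurable_sum measurable_component_singleton) auto
  moreover have "(\<lambda>f. \<Sum>j. f (j + n)) \<in> borel_measurable (PiM {n..} (\<lambda>_. borel :: real measure))"
    by (intro borel_measurable_suminf measurable_component_singleton) auto
  moreover have "{..<n} \<inter> {n..} = {}" by auto
  ultimately have "indep_var borel (\<lambda>\<omega>. \<Sum>j<n. restrict (\<lambda>i. Y i \<omega>) {..<n} j)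
      borel (\<lambda>\<omega>. \<Sum>j. restrict (\<lambda>i. Y i \<omega>) {n..} (j + n))"
    by (intro indep_var_functions_of_disjoint[OF ind])
  then show ?thesis by simp
qed

text \<open>An independent summand without atoms would make the whole sum atomless. This supplies
  values for the finitely many early indices, where the tail sums need not have a large
  atom.\<close>

lemma (in prob_space) summand_atom_of_suminf_atom:
  fixes Y :: "nat \<Rightarrow> 'a \<Rightarrow> real"
  assumes ind: "indep_vars (\<lambda>_. borel) Y UNIV"
    and conv: "AE \<omega> in M. summable (\<lambda>j. Y j \<omega>)"
    and atom: "prob {\<omega> \<in> space M. (\<Sum>j. Y j \<omega>) = c} > 0"
  shows "\<exists>z. prob {\<omega> \<in> space M. Y j \<omega> = z} > 0"
proof (rule ccontr)
  assume "\<not> ?thesis"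
  then have q: "prob {\<omega> \<in> space M. Y j \<omega> = z} \<le> 0" for z
    by (simp add: not_less)
  have [measurable]: "random_variable borel (Y i)" for i
    using ind by (auto simp: indep_vars_def)
  \<comment> \<open>Replacing the \<open>j\<close>-th term by 0 keeps the indexing of the series and
    makes it a function of the other coordinates only; the \<open>if\<close> also hides the
    undefined value that \<open>restrict\<close> gives at \<open>j\<close>.\<close>
  let ?X = "\<lambda>\<omega>. \<Sum>i. if i = j then 0 else Y i \<omega>"
  have 1: "(\<lambda>f. \<Sum>i. if i = j then 0 else f i) \<in> borel_measurable (PiM (- {j}) (\<lambda>_. borel :: real measure))"
    (is "?F \<in> _")
  proof (intro borel_measurable_suminf)
    fix i
    show "(\<lambda>f. if i = j then 0 else f i) \<in> borel_measurable (PiM (- {j}) (\<lambda>_. borel :: real measure))"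
      by (cases "i = j") auto
  qed
  have 2: "(\<lambda>f. f j) \<in> borel_measurable (PiM {j} (\<lambda>_. borel :: real measure))"
    by (intro measurable_component_singleton) auto
  have "?F (restrict (\<lambda>i. Y i \<omega>) (- {j})) = ?X \<omega>" for \<omega>
    by (intro arg_cong[where f=suminf]) auto
  then have iv: "indep_var borel ?X borel (Y j)"
    using indep_var_functions_of_disjoint[OF ind _ 1 2] by simp
  have "prob {\<omega> \<in> space M. ?X \<omega> \<in> UNIV \<and> ?X \<omega> + Y j \<omega> = c} \<le> 0"
    using prob_indep_add_eq_le[OF iv _ q, of UNIV c] by simp
  moreover have "prob {\<omega> \<in> space M. ?X \<omega> \<in> UNIV \<and> ?X \<omega> + Y j \<omega> = c}
      = prob {\<omega> \<in> space M. (\<Sum>j. Y j \<omega>) = c}"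
  proof (rule finite_measure_eq_AE)
    show "AE \<omega> in M. \<omega> \<in> {\<omega> \<in> space M. ?X \<omega> \<in> UNIV \<and> ?X \<omega> + Y j \<omega> = c}
        \<longleftrightarrow> \<omega> \<in> {\<omega> \<in> space M. (\<Sum>j. Y j \<omega>) = c}"
      using conv
    proof eventually_elim
      case (elim \<omega>)
      have "(\<lambda>i. if i = j then Y i \<omega> else 0) sums Y j \<omega>" by (rule sums_single)
      from sums_diff[OF summable_sums[OF elim] this]
      have "(\<lambda>i. if i = j then 0 else Y i \<omega>) sums ((\<Sum>j. Y j \<omega>) - Y j \<omega>)"
        by (rule sums_cong[THEN iffD1, rotated]) auto
      then show ?case by (auto simp: sums_iff)
    qed
  qed auto
  ultimately show False using atom by simp
qed

text \<open>If \<open>Y j\<close> is the first of the variables to differ from \<open>c j = r j - r (Suc j)\<close>, then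
  \<open>R N = r N\<close> forces \<open>R (Suc j) \<noteq> r (Suc j)\<close>, and the latter event is independent of the past.\<close>

lemma (in prob_space) prob_all_eq_ge_of_tail_atoms:
  fixes Y :: "nat \<Rightarrow> 'a \<Rightarrow> real" and r :: "nat \<Rightarrow> real"
  assumes ind: "indep_vars (\<lambda>_. borel) Y UNIV"
    and conv: "AE \<omega> in M. summable (\<lambda>j. Y j \<omega>)"
    and R_def: "\<And>n \<omega>. R n \<omega> = (\<Sum>j. Y (j + n) \<omega>)"
    and r: "\<And>n. n \<ge> N \<Longrightarrow> prob {\<omega> \<in> space M. R n \<omega> \<noteq> r n} \<le> e"
  shows "prob {\<omega> \<in> space M. \<forall>i\<in>{N..<m}. Y i \<omega> = r i - r (Suc i)} \<ge> 1 - 2 * e"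
proof -
  define c where "c i = r i - r (Suc i)" for i
  have [measurable]: "random_variable borel (Y i)" for i
    using ind by (auto simp: indep_vars_def)
  have [measurable]: "random_variable borel (R n)" for n
    unfolding R_def[abs_def] by measurable
  define F where "F j = {\<omega> \<in> space M. (\<forall>i\<in>{N..<j}. Y i \<omega> = c i) \<and> Y j \<omega> \<noteq> c j}" for j
  define G where "G j = {\<omega> \<in> space M. R (Suc j) \<omega> \<noteq> r (Suc j)}" for j
  have [measurable]: "F j \<in> events" "G j \<in> events" for j
    unfolding F_def G_def by measurable
  have FG: "prob (F j \<inter> G j) = prob (F j) * prob (G j)" for j
  proof -
    \<comment> \<open>\<open>F j\<close> is an event of the coordinates up to \<open>j\<close>, and
      \<open>G j\<close> one of the coordinates beyond \<open>j\<close>. The guard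
      \<open>i \<in> {..j}\<close> keeps each \<open>f i\<close> inside the index set of the
      product, where it is a measurable projection.\<close>
    let ?A = "{f \<in> space (PiM {..j} (\<lambda>_. borel :: real measure)). (\<forall>i\<in>{N..<j}. i \<in> {..j} \<longrightarrow> f i = c i) \<and> f j \<noteq> c j}"
    let ?B = "{f \<in> space (PiM {Suc j..} (\<lambda>_. borel :: real measure)). (\<Sum>i. f (i + Suc j)) \<noteq> r (Suc j)}"
    have 1: "?A \<in> sets (PiM {..j} (\<lambda>_. borel))"
      by measurable
    have "(\<lambda>f. \<Sum>i. f (i + Suc j)) \<in> borel_measurable (PiM {Suc j..} (\<lambda>_. borel :: real measure))"
      by (intro borel_measurable_suminf measurable_component_singleton) auto
    then have 2: "?B \<in> sets (PiM {Suc j..} (\<lambda>_. borel))"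
      by measurable
    have "indep_var (PiM {..j} (\<lambda>_. borel)) (\<lambda>\<omega>. restrict (\<lambda>i. Y i \<omega>) {..j})
        (PiM {Suc j..} (\<lambda>_. borel)) (\<lambda>\<omega>. restrict (\<lambda>i. Y i \<omega>) {Suc j..})"
      by (rule indep_var_restrict[OF ind]) auto
    from indep_varD[OF this 1 2]
    have "prob ((\<lambda>\<omega>. (restrict (\<lambda>i. Y i \<omega>) {..j}, restrict (\<lambda>i. Y i \<omega>) {Suc j..})) -` (?A \<times> ?B) \<inter> space M)
      = prob ((\<lambda>\<omega>. restrict (\<lambda>i. Y i \<omega>) {..j}) -` ?A \<inter> space M) *
        prob ((\<lambda>\<omega>. restrict (\<lambda>i. Y i \<omega>) {Suc j..}) -` ?B \<inter> space M)" .
    moreover have "(\<lambda>\<omega>. (restrict (\<lambda>i. Y i \<omega>) {..j}, restrict (\<lambda>i. Y i \<omega>) {Suc j..})) -` (?A \<times> ?B) \<inter> space M = F j \<inter> G j"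
      by (auto simp: F_def G_def R_def space_PiM)
    moreover have "(\<lambda>\<omega>. restrict (\<lambda>i. Y i \<omega>) {..j}) -` ?A \<inter> space M = F j"
      by (auto simp: F_def space_PiM)
    moreover have "(\<lambda>\<omega>. restrict (\<lambda>i. Y i \<omega>) {Suc j..}) -` ?B \<inter> space M = G j"
      by (auto simp: G_def R_def space_PiM)
    ultimately show ?thesis by simp
  qed
  have disj: "disjoint_family_on F {N..<m}"
  proof -
    have "F i \<inter> F j = {}" if "N \<le> i" "i < j" for i j
      using that by (auto simp: F_def)
    then show ?thesis
      unfolding disjoint_family_on_def by (metis Int_commute atLeastLessThan_iff nat_neq_iff)
  qed
  have e0: "0 \<le> e" using r[of N] measure_nonneg order_trans by blast
  let ?H = "{\<omega> \<in> space M. \<forall>i\<in>{N..<m}. Y i \<omega> = c i}"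
  let ?U = "\<Union>j\<in>{N..<m}. F j \<inter> G j"
  \<comment> \<open>The events \<open>F j\<close> of a first departure at \<open>j\<close> are
    disjoint, so their probabilities add up to at most 1. The union bound therefore costs a single
    \<open>e\<close>, independently of \<open>m\<close>.\<close>
  have "prob ?U \<le> (\<Sum>j\<in>{N..<m}. prob (F j \<inter> G j))"
    by (intro finite_measure_subadditive_finite) auto
  also have "\<dots> \<le> (\<Sum>j\<in>{N..<m}. prob (F j) * e)"
    unfolding FG using r by (intro sum_mono mult_left_mono) (auto simp: G_def)
  also have "\<dots> = prob (\<Union>j\<in>{N..<m}. F j) * e"
    using disj by (subst finite_measure_finite_Union) (auto simp: sum_distrib_right)
  also have "\<dots> \<le> 1 * e"
    using e0 by (intro mult_right_mono) auto
  finally have U: "prob ?U \<le> e" by simp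
  \<comment> \<open>Up to a null set \<open>R N = r N\<close> is covered by \<open>?H\<close>, where
    no departure occurs before \<open>m\<close>, and \<open>?U\<close>. Removing the at most
    \<open>e\<close> for \<open>?U\<close> leaves \<open>1 - 2 * e\<close> for
    \<open>?H\<close>.\<close>
  have "1 - e \<le> prob {\<omega> \<in> space M. R N \<omega> = r N}"
    using r[of N] prob_neg[of "\<lambda>\<omega>. R N \<omega> = r N"] by simp
  also have "\<dots> \<le> prob (?H \<union> ?U)"
  proof (rule finite_measure_mono_AE)
    show "AE \<omega> in M. \<omega> \<in> {\<omega> \<in> space M. R N \<omega> = r N} \<longrightarrow> \<omega> \<in> ?H \<union> ?U"
      using conv
    proof eventually_elim
      case (elim \<omega>)
      show ?case
      proof
        assume *: "\<omega> \<in> {\<omega> \<in> space M. R N \<omega> = r N}"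
        show "\<omega> \<in> ?H \<union> ?U"
        proof (cases "\<omega> \<in> ?H")
          case False
          \<comment> \<open>The minimum is over all indices from \<open>N\<close> on; the departure
            \<open>i < m\<close> bounds it, so \<open>j < m\<close> as well.\<close>
          define j where "j = (LEAST j. N \<le> j \<and> Y j \<omega> \<noteq> c j)"
          obtain i where i: "N \<le> i" "i < m" "Y i \<omega> \<noteq> c i"
            using False * by auto
          have j: "N \<le> j" "Y j \<omega> \<noteq> c j"
            using LeastI[of "\<lambda>j. N \<le> j \<and> Y j \<omega> \<noteq> c j" i] i by (auto simp: j_def)
          have jm: "j < m"
            using Least_le[of "\<lambda>j. N \<le> j \<and> Y j \<omega> \<noteq> c j" i] i by (auto simp: j_def)
          have before: "Y k \<omega> = c k" if "N \<le> k" "k < j" for k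
            using not_less_Least[of k "\<lambda>j. N \<le> j \<and> Y j \<omega> \<noteq> c j"] that by (auto simp: j_def)
          \<comment> \<open>The terms before \<open>j\<close> telescope to \<open>r N - r j\<close>.
            Splitting \<open>R N = r N\<close> after index \<open>j\<close> gives
            \<open>R (Suc j) = r j - Y j\<close>, which differs from \<open>r (Suc j)\<close>
            because \<open>Y j\<close> differs from \<open>c j\<close>.\<close>
          have "(\<Sum>k\<in>{N..<j}. Y k \<omega>) = (\<Sum>k\<in>{N..<j}. c k)"
            using before by (intro sum.cong) auto
          also have "\<dots> = r N - r j"
            using sum_Suc_diff'[of N j "\<lambda>i. - r i"] j by (simp add: c_def)
          finally have "r N = r N - r j + Y j \<omega> + R (Suc j) \<omega>"
            using * j suminf_eq_sum_plus_tail[OF elim, of N "Suc j"] by (simp add: R_def)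
          then have "R (Suc j) \<omega> \<noteq> r (Suc j)"
            using j by (auto simp: c_def)
          then have "\<omega> \<in> F j \<inter> G j"
            using j before * by (auto simp: F_def G_def)
          then show ?thesis using j jm by auto
        qed simp
      qed
    qed
  qed auto
  also have "\<dots> \<le> prob ?H + prob ?U"
    by (intro measure_Un_le) auto
  finally show ?thesis using U by (simp add: c_def)
qed

section \<open>Products of probabilities and summability\<close>

lemma (in prob_space) prob_all_eq_indep:
  fixes Y :: "'i \<Rightarrow> 'a \<Rightarrow> real"
  assumes ind: "indep_vars (\<lambda>_. borel) Y UNIV" and "finite J"
  shows "prob {\<omega> \<in> space M. \<forall>i\<in>J. Y i \<omega> = c i} = (\<Prod>i\<in>J. prob {\<omega> \<in> space M. Y i \<omega> = c i})"
\<comment> \<open>The product rule for independent events is applied to a nonempty index set; for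
  the empty one both sides are 1.\<close>
proof (cases "J = {}")
  case False
  have "prob (\<Inter>i\<in>J. Y i -` {c i} \<inter> space M) = (\<Prod>i\<in>J. prob (Y i -` {c i} \<inter> space M))"
    using False assms by (intro indep_varsD[OF ind]) auto
  moreover have "(\<Inter>i\<in>J. Y i -` {c i} \<inter> space M) = {\<omega> \<in> space M. \<forall>i\<in>J. Y i \<omega> = c i}"
    using False by auto
  moreover have "Y i -` {c i} \<inter> space M = {\<omega> \<in> space M. Y i \<omega> = c i}" for i
    by auto
  ultimately show ?thesis by simp
qed (simp add: prob_space)

text \<open>By \<open>1 - x \<le> exp (- x)\<close> the product is at most the exponential of minus
  the partial sum, so a lower bound \<open>d\<close> on the products bounds the partial sums from
  \<open>N\<close> on by \<open>- ln d\<close>.\<close>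

lemma summable_of_prod_bounded_below:
  fixes p :: "nat \<Rightarrow> real"
  assumes p: "\<And>j. 0 \<le> p j" "\<And>j. p j \<le> 1"
    and d: "0 < d" "\<And>m. d \<le> (\<Prod>j\<in>{N..<m}. 1 - p j)"
  shows "summable p"
proof -
  have "summable (\<lambda>j. p (j + N))"
  proof (rule summableI_nonneg_bounded)
    fix n
    have "d \<le> (\<Prod>j\<in>{N..<n + N}. 1 - p j)" by (rule d)
    also have "\<dots> = (\<Prod>j<n. 1 - p (j + N))"
      using prod.shift_bounds_nat_ivl[of "\<lambda>j. 1 - p j" 0 N n] by (simp add: atLeast0LessThan)
    also have "\<dots> \<le> (\<Prod>j<n. exp (- p (j + N)))"
    proof (intro prod_mono conjI)
      fix j show "1 - p (j + N) \<le> exp (- p (j + N))"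
        using exp_ge_add_one_self[of "- p (j + N)"] by simp
    qed (use p in auto)
    also have "\<dots> = exp (- (\<Sum>j<n. p (j + N)))"
      by (simp add: sum_negf flip: exp_sum)
    finally have "ln d \<le> ln (exp (- (\<Sum>j<n. p (j + N))))"
      using d(1) by (subst ln_le_cancel_iff) auto
    then show "(\<Sum>j<n. p (j + N)) \<le> - ln d" by simp
  qed (use p in auto)
  then show ?thesis by (simp add: summable_iff_shift)
qed

text \<open>By independence and continuity from above the probability is the infinite product of the
  \<open>1 - p j\<close>. Such a product is positive when all factors are positive and the
  \<open>p j\<close> are summable.\<close>

lemma (in prob_space) prob_all_eq_pos:
  fixes Y :: "nat \<Rightarrow> 'a \<Rightarrow> real"
  assumes ind: "indep_vars (\<lambda>_. borel) Y UNIV"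
    and pos: "\<And>j. prob {\<omega> \<in> space M. Y j \<omega> = c j} > 0"
    and sum: "summable (\<lambda>j. prob {\<omega> \<in> space M. Y j \<omega> \<noteq> c j})"
  shows "prob {\<omega> \<in> space M. \<forall>j. Y j \<omega> = c j} > 0"
proof -
  have [measurable]: "random_variable borel (Y i)" for i
    using ind by (auto simp: indep_vars_def)
  define p where "p j = prob {\<omega> \<in> space M. Y j \<omega> \<noteq> c j}" for j
  \<comment> \<open>The form \<open>1 + - p j\<close> matches the convergence criterion for products
    of factors \<open>1 + z k\<close> with absolutely summable \<open>z\<close>.\<close>
  have p: "prob {\<omega> \<in> space M. Y j \<omega> = c j} = 1 + - p j" for j
    using prob_neg[of "\<lambda>\<omega>. Y j \<omega> = c j"] by (simp add: p_def)
  define H where "H n = {\<omega> \<in> space M. \<forall>i\<in>{..n}. Y i \<omega> = c i}" for n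
  have H: "prob (H n) = (\<Prod>i\<le>n. 1 + - p i)" for n
    unfolding H_def using prob_all_eq_indep[OF ind, of "{..n}" c] by (simp add: p)
  have p_nz: "1 + - p j > 0" for j using pos[of j] p[of j] by simp
  have cp: "convergent_prod (\<lambda>j. 1 + - p j)"
  proof (rule summable_imp_convergent_prod_real)
    show "summable (\<lambda>k. \<bar>- p k\<bar>)" using sum by (simp add: p_def)
    show "- p k \<noteq> - 1" for k using p_nz[of k] by simp
  qed
  have "(\<lambda>n. prob (H n)) \<longlonglongrightarrow> prodinf (\<lambda>j. 1 + - p j)"
    unfolding H using convergent_prod_LIMSEQ[OF cp] .
  moreover have "(\<lambda>n. prob (H n)) \<longlonglongrightarrow> prob (\<Inter>n. H n)"
    by (intro finite_Lim_measure_decseq) (auto simp: H_def decseq_def)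
  moreover have "(\<Inter>n. H n) = {\<omega> \<in> space M. \<forall>j. Y j \<omega> = c j}"
    by (auto simp: H_def)
  ultimately have "prob {\<omega> \<in> space M. \<forall>j. Y j \<omega> = c j} = prodinf (\<lambda>j. 1 + - p j)"
    using LIMSEQ_unique by metis
  then show ?thesis using less_0_prodinf[OF cp p_nz] by simp
qed

section \<open>Both directions of the atom criterion for the series\<close>

theorem theorem1p13:
  fixes M :: "'a measure" and Y :: "nat \<Rightarrow> 'a \<Rightarrow> real"
  assumes "prob_space M"
    and "prob_space.indep_vars M (\<lambda>_. borel) Y UNIV"
    and "AE \<omega> in M. summable (\<lambda>j. Y j \<omega>)"
  shows "distribution_contains_atom M (\<lambda>\<omega>. \<Sum>j. Y j \<omega>) \<longleftrightarrow>
    (\<exists>c :: nat \<Rightarrow> real.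
      (\<forall>j. measure M {\<omega> \<in> space M. Y j \<omega> = c j} > 0) \<and>
      summable (\<lambda>j. measure M {\<omega> \<in> space M. Y j \<omega> \<noteq> c j}))"
proof -
  interpret prob_space M by fact
  note ind = assms(2) and conv = assms(3)
  have [measurable]: "random_variable borel (Y i)" for i
    using ind by (auto simp: indep_vars_def)
  define R where "R n \<omega> = (\<Sum>j. Y (j + n) \<omega>)" for n \<omega>
  have [measurable]: "random_variable borel (R n)" for n
    unfolding R_def[abs_def] by measurable
  have compl: "prob {\<omega> \<in> space M. f \<omega> \<noteq> (z::real)} = 1 - prob {\<omega> \<in> space M. f \<omega> = z}"
    if [measurable]: "random_variable borel f" for f z
    using prob_neg[of "\<lambda>\<omega>. f \<omega> = z"] by simp
  show ?thesis
    unfolding distribution_contains_atom_def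
  proof (intro iffI; elim exE conjE)
    fix s assume s: "0 < prob {\<omega> \<in> space M. (\<Sum>j. Y j \<omega>) = s}"
    \<comment> \<open>With mass above 3/4 the exceptional events have probability at most
      \<open>e = 1/4\<close>, so \<open>1 - 2 * e = 1/2\<close> remains positive.\<close>
    have "\<forall>\<^sub>F n in sequentially. \<exists>z. prob {\<omega> \<in> space M. R n \<omega> = z} > 3/4"
    proof (rule residual_atom_of_limit_atom[OF _ _ _ _ s])
      show "indep_var borel (\<lambda>\<omega>. \<Sum>j<n. Y j \<omega>) borel (R n)" for n
        using indep_partial_sum_tail[OF ind] by (simp add: R_def[abs_def])
      show "AE \<omega> in M. (\<lambda>n. \<Sum>j<n. Y j \<omega>) \<longlonglongrightarrow> (\<Sum>j. Y j \<omega>)"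
        using conv by eventually_elim (rule summable_LIMSEQ)
      show "AE \<omega> in M. (\<Sum>j<n. Y j \<omega>) + R n \<omega> = (\<Sum>j. Y j \<omega>)" for n
        using conv by eventually_elim (simp add: R_def suminf_split_initial_segment[of _ n])
    qed auto
    then obtain N where "\<And>n. n \<ge> N \<Longrightarrow> \<exists>z. prob {\<omega> \<in> space M. R n \<omega> = z} > 3/4"
      by (auto simp: eventually_sequentially)
    then obtain r where "\<And>n. n \<ge> N \<Longrightarrow> prob {\<omega> \<in> space M. R n \<omega> = r n} > 3/4"
      by metis
    then have r: "prob {\<omega> \<in> space M. R n \<omega> \<noteq> r n} \<le> 1/4" if "n \<ge> N" for n
      using that by (force simp: compl)
    obtain a where a: "\<And>j. prob {\<omega> \<in> space M. Y j \<omega> = a j} > 0"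
      using summand_atom_of_suminf_atom[OF ind conv s] by metis
    \<comment> \<open>From \<open>N\<close> on the value is the one forced by consecutive tail
      atoms; below \<open>N\<close> any atom of \<open>Y j\<close> serves, since finitely many terms
      do not affect summability.\<close>
    define c where "c j = (if j < N then a j else r j - r (Suc j))" for j
    \<comment> \<open>The bound 1/2 is uniform in \<open>m\<close>. It yields both remaining claims:
      no factor with index at least \<open>N\<close> vanishes, and the complementary probabilities
      are summable.\<close>
    have prod: "(\<Prod>j\<in>{N..<m}. prob {\<omega> \<in> space M. Y j \<omega> = c j}) \<ge> 1/2" for m
    proof -
      have "1/2 \<le> prob {\<omega> \<in> space M. \<forall>i\<in>{N..<m}. Y i \<omega> = r i - r (Suc i)}"
        using prob_all_eq_ge_of_tail_atoms[OF ind conv R_def r, of N m] by simp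
      also have "\<dots> = prob {\<omega> \<in> space M. \<forall>i\<in>{N..<m}. Y i \<omega> = c i}"
        by (simp add: c_def)
      finally show ?thesis by (simp add: prob_all_eq_indep[OF ind])
    qed
    have "prob {\<omega> \<in> space M. Y j \<omega> = c j} > 0" for j
    proof (cases "j < N")
      case False
      then have "(\<Prod>j\<in>{N..<Suc j}. prob {\<omega> \<in> space M. Y j \<omega> = c j}) \<noteq> 0"
        using prod[of "Suc j"] by linarith
      then have "prob {\<omega> \<in> space M. Y j \<omega> = c j} \<noteq> 0"
        using False by (simp add: not_less)
      then show ?thesis using measure_nonneg less_le by metis
    qed (simp add: c_def a)
    moreover have "summable (\<lambda>j. prob {\<omega> \<in> space M. Y j \<omega> \<noteq> c j})"
      by (rule summable_of_prod_bounded_below[where d="1/2" and N=N]) (use prod in \<open>auto simp: compl\<close>)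
    ultimately show "\<exists>c. (\<forall>j. 0 < prob {\<omega> \<in> space M. Y j \<omega> = c j}) \<and>
        summable (\<lambda>j. prob {\<omega> \<in> space M. Y j \<omega> \<noteq> c j})"
      by blast
  next
    fix c :: "nat \<Rightarrow> real"
    assume "\<forall>j. 0 < prob {\<omega> \<in> space M. Y j \<omega> = c j}"
      and "summable (\<lambda>j. prob {\<omega> \<in> space M. Y j \<omega> \<noteq> c j})"
    then have "0 < prob {\<omega> \<in> space M. \<forall>j. Y j \<omega> = c j}"
      by (intro prob_all_eq_pos[OF ind]) auto
    \<comment> \<open>On this event the two series agree term by term, so \<open>suminf\<close>
      assigns them the same value, and the atom sits at \<open>\<Sum>j. c j\<close>.\<close>
    also have "\<dots> \<le> prob {\<omega> \<in> space M. (\<Sum>j. Y j \<omega>) = (\<Sum>j. c j)}"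
      by (intro finite_measure_mono) auto
    finally show "\<exists>s. 0 < prob {\<omega> \<in> space M. (\<Sum>j. Y j \<omega>) = s}" ..
  qed
qed

end
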